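(* Let $a\in(0,1)$ and $z>0$. Then $$\lim_{n\to\infty} P_n^T\bigl(z;2\lfloor an/2\rfloor\bigr)=\lim_{\substack{n\to\infty\\ n\ \mathrm{even}}} P_n^D\bigl(z;2\lfloor an/2\rfloor\bigr)=\begin{cases}0,&\text{if } z\le 2,\\ -\log(z-1),&\text{if } z>2.\end{cases}$$
   Context: A positive path of length $n$ is a lattice path in $\mathbb{Z}^2$ starting at the origin, consisting of $n$ steps each equal to $(1,1)$ or $(1,-1)$, and never going below the line $Y=0$. A Dyck path of (even) length $n$ is a positive path of length $n$ ending on the line $Y=0$. A visit is a vertex of the path on $Y=0$ other than the origin (the origin is not weighted). For $z>0$, let $T_n(z)=\sum z^{\#\text{visits}}$, the sum being over all positive paths of length $n$, and for even $n$ let $D_n(z)=\sum z^{\#\text{visits}}$, the sum being over all Dyck paths of length $n$ (so $T_0(z)=D_0(z)=1$). For a vertex $(q,0)$ with $0<q<n$, let $T_n(z;q)$ (respectively $D_n(z;q)$, $n$ even) be the same sums restricted to paths that do not pass through $(q,0)$. The pressure at $(q,0)$ is $$P_n^T(z;q)=\log T_n(z;q)-\log T_n(z),\qquad P_n^D(z;q)=\log D_n(z;q)-\log D_n(z).$$ For even $q$ these equal $\log\bigl(1-D_q(z)T_{n-q}(z)/T_n(z)\bigr)$ and $\log\bigl(1-D_q(z)D_{n-q}(z)/D_n(z)\bigr)$ respectively. The limits are over $n$ large enough that $0<2\lfloor an/2\rfloor<n$ (and $n$ even in the Dyck case). *)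

theory Defs
  imports "HOL-Analysis.Analysis"
begin

text \<open>
  A path is represented by its list of steps in \<open>\<int> \<times> \<int>\<close>; its vertices are the partial sums of
  that list. All vertices have distinct abscissae, so counting vertices as a set loses nothing.
\<close>

type_synonym step = "int \<times> int"

definition vertices :: "step list \<Rightarrow> (int \<times> int) set" where
  "vertices p = (\<lambda>k. sum_list (take k p)) ` {0..length p}"

definition positive_paths :: "nat \<Rightarrow> step list set" where
  "positive_paths n =
     {p. length p = n \<and> set p \<subseteq> {(1, 1), (1, -1)} \<and> (\<forall>v \<in> vertices p. snd v \<ge> 0)}"

definition dyck_paths :: "nat \<Rightarrow> step list set" where
  "dyck_paths n = {p \<in> positive_paths n. snd (sum_list p) = 0}"

definition visits :: "step list \<Rightarrow> (int \<times> int) set" where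
  "visits p = {v \<in> vertices p. snd v = 0 \<and> v \<noteq> (0, 0)}"

definition T :: "nat \<Rightarrow> real \<Rightarrow> real" where
  "T n z = (\<Sum>p \<in> positive_paths n. z ^ card (visits p))"

text \<open>For odd \<open>n\<close> there are no Dyck paths, so \<open>D n z = 0\<close>; only even \<open>n\<close> is meaningful below.\<close>

definition D :: "nat \<Rightarrow> real \<Rightarrow> real" where
  "D n z = (\<Sum>p \<in> dyck_paths n. z ^ card (visits p))"

definition T_avoiding :: "nat \<Rightarrow> real \<Rightarrow> int \<Rightarrow> real" where
  "T_avoiding n z q = (\<Sum>p \<in> {p \<in> positive_paths n. (q, 0) \<notin> vertices p}. z ^ card (visits p))"

definition D_avoiding :: "nat \<Rightarrow> real \<Rightarrow> int \<Rightarrow> real" where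
  "D_avoiding n z q = (\<Sum>p \<in> {p \<in> dyck_paths n. (q, 0) \<notin> vertices p}. z ^ card (visits p))"

text \<open>
  The pressures are meaningful for \<open>0 < q < n\<close>. Outside this range the sum in the numerator may be
  empty, and \<open>ln 0 = 0\<close> is then a junk value.
\<close>

definition pressure_T :: "nat \<Rightarrow> real \<Rightarrow> int \<Rightarrow> real" where
  "pressure_T n z q = ln (T_avoiding n z q) - ln (T n z)"

definition pressure_D :: "nat \<Rightarrow> real \<Rightarrow> int \<Rightarrow> real" where
  "pressure_D n z q = ln (D_avoiding n z q) - ln (D n z)"

lemma finite_positive_paths: "finite (positive_paths n)"
proof (rule finite_subset)
  show "positive_paths n \<subseteq> {p. set p \<subseteq> {(1, 1), (1, -1)} \<and> length p = n}"
    by (auto simp: positive_paths_def)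
qed (simp add: finite_lists_length_eq)

lemma finite_dyck_paths: "finite (dyck_paths n)"
  by (simp add: dyck_paths_def finite_positive_paths)

end

theory Submission
  imports Defs
begin

text \<open>
  Splitting a path at \<open>(q, 0)\<close> shows that the pressure is \<open>ln (1 - R)\<close>, where \<open>R\<close> is \<open>D\<^sub>q T\<^bsub>n-q\<^esub> / T\<^sub>n\<close>
  or \<open>D\<^sub>q D\<^bsub>n-q\<^esub> / D\<^sub>n\<close>. With the Catalan numbers \<open>c\<^sub>m\<close> one has
  \<open>(z - 1) D\<^bsub>2m+2\<^esub> = z\<^sup>2 D\<^bsub>2m\<^esub> - z c\<^sub>m\<close>. For \<open>z \<le> 2\<close> this gives
  \<open>D\<^bsub>2m\<^esub>\<close> of order \<open>4\<^sup>m / m\<^sup>s\<close> with \<open>s = 1/2\<close> (\<open>z = 2\<close>) or \<open>s = 3/2\<close> (\<open>z < 2\<close>), and the polynomial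
  factors force \<open>R\<close> to \<open>0\<close>. For \<open>z > 2\<close> the growth is purely exponential:
  \<open>D\<^bsub>2m\<^esub> \<sim> (z - 2) / (z - 1) l\<^sup>m\<close> with \<open>l = z\<^sup>2 / (z - 1) > 4\<close>, while \<open>T\<^sub>n\<close> grows at the same rate along
  each parity class, so \<open>R\<close> tends to the constant \<open>(z - 2) / (z - 1)\<close>.
\<close>

section \<open>Path sums by final height\<close>

text \<open>Letting the weight of a visit depend on its abscissa turns the sums over paths avoiding
  \<open>(q, 0)\<close> into the case where the weight at \<open>q\<close> is \<open>0\<close>.\<close>

fun height_sum :: "(nat \<Rightarrow> real) \<Rightarrow> nat \<Rightarrow> nat \<Rightarrow> real" where
  "height_sum w 0 h = (if h = 0 then 1 else 0)"
| "height_sum w (Suc n) 0 = w (Suc n) * height_sum w n 1"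
| "height_sum w (Suc n) (Suc h) = height_sum w n h + height_sum w n (Suc (Suc h))"

definition paths_to :: "nat \<Rightarrow> nat \<Rightarrow> step list set" where
  "paths_to n h = {p \<in> positive_paths n. snd (sum_list p) = int h}"

definition visit_weight :: "(nat \<Rightarrow> real) \<Rightarrow> step list \<Rightarrow> real" where
  "visit_weight w p = (\<Prod>v\<in>visits p. w (nat (fst v)))"

section \<open>Vertices and visits under appending a last step\<close>

lemma vertices_snoc: "vertices (p @ [s]) = insert (sum_list p + s) (vertices p)"
proof -
  have "vertices (p @ [s]) = (\<lambda>k. sum_list (take k (p @ [s]))) ` insert (Suc (length p)) {0..length p}"
    by (simp add: vertices_def atLeastAtMostSuc_conv)
  also have "\<dots> = insert (sum_list p + s) (vertices p)"
    by (auto simp: vertices_def)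
  finally show ?thesis .
qed

lemma sum_list_in_vertices: "sum_list p \<in> vertices p"
  by (auto simp: vertices_def intro!: image_eqI[where x = "length p"])

lemma finite_visits: "finite (visits p)"
  by (simp add: visits_def vertices_def)

lemma fst_sum_list_steps:
  "set p \<subseteq> {(1, 1), (1, -1)} \<Longrightarrow> fst (sum_list p) = int (length p)"
  by (induction p) auto

lemma fst_vertices_bounds:
  assumes "set p \<subseteq> {(1, 1), (1, -1)}" and "v \<in> vertices p"
  shows "0 \<le> fst v \<and> fst v \<le> int (length p)"
proof -
  obtain k where "v = sum_list (take k p)" using assms(2) by (auto simp: vertices_def)
  moreover have "set (take k p) \<subseteq> {(1, 1), (1, -1)}" using assms(1) set_take_subset by fast
  ultimately show ?thesis by (simp add: fst_sum_list_steps)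
qed

lemma positive_paths_0: "positive_paths 0 = {[]}"
  by (auto simp: positive_paths_def vertices_def)

lemma snoc_in_positive_paths:
  "p @ [s] \<in> positive_paths (Suc n) \<longleftrightarrow>
     p \<in> positive_paths n \<and> s \<in> {(1, 1), (1, -1)} \<and> 0 \<le> snd (sum_list p) + snd s"
  by (auto simp: positive_paths_def vertices_snoc)

lemma positive_paths_snocE:
  assumes "p \<in> positive_paths (Suc n)"
  obtains p' s where "p = p' @ [s]"
  using assms by (cases p rule: rev_cases) (auto simp: positive_paths_def)

lemma height_nonneg: "p \<in> positive_paths n \<Longrightarrow> 0 \<le> snd (sum_list p)"
  using sum_list_in_vertices by (auto simp: positive_paths_def)

lemma height_le:
  assumes "p \<in> positive_paths n"
  shows "snd (sum_list p) \<le> int n"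
proof -
  have "snd (sum_list p) \<le> int (length p)" if "set p \<subseteq> {(1, 1), (1, -1)}"
    using that by (induction p) auto
  with assms show ?thesis by (auto simp: positive_paths_def)
qed

lemma paths_to_Suc_0: "paths_to (Suc n) 0 = (\<lambda>p. p @ [(1, -1)]) ` paths_to n 1"
proof (intro set_eqI iffI)
  fix p assume p: "p \<in> paths_to (Suc n) 0"
  then obtain p' s where ps: "p = p' @ [s]"
    by (auto simp: paths_to_def elim: positive_paths_snocE)
  with p have p': "p' \<in> positive_paths n" "s \<in> {(1, 1), (1, -1)}" "snd (sum_list p') + snd s = 0"
    by (auto simp: paths_to_def snoc_in_positive_paths)
  with height_nonneg[OF p'(1)] show "p \<in> (\<lambda>p. p @ [(1, -1)]) ` paths_to n 1"
    by (auto simp: paths_to_def ps)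
qed (auto simp: paths_to_def snoc_in_positive_paths)

lemma paths_to_Suc_Suc:
  "paths_to (Suc n) (Suc h) =
     (\<lambda>p. p @ [(1, 1)]) ` paths_to n h \<union> (\<lambda>p. p @ [(1, -1)]) ` paths_to n (Suc (Suc h))"
proof (intro set_eqI iffI)
  fix p assume p: "p \<in> paths_to (Suc n) (Suc h)"
  then obtain p' s where ps: "p = p' @ [s]"
    by (auto simp: paths_to_def elim: positive_paths_snocE)
  with p show "p \<in> (\<lambda>p. p @ [(1, 1)]) ` paths_to n h
      \<union> (\<lambda>p. p @ [(1, -1)]) ` paths_to n (Suc (Suc h))"
    by (auto simp: paths_to_def snoc_in_positive_paths)
qed (auto simp: paths_to_def snoc_in_positive_paths)

lemma finite_paths_to: "finite (paths_to n h)"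
  by (simp add: paths_to_def finite_positive_paths)

text \<open>The new vertex has abscissa \<open>Suc n\<close>, beyond every vertex of
  \<open>p\<close>, so it cannot coincide with an earlier visit and the product gains exactly one
  factor.\<close>

lemma visit_weight_snoc:
  assumes "p @ [s] \<in> positive_paths (Suc n)"
  shows "visit_weight w (p @ [s]) =
    (if snd (sum_list p + s) = 0 then w (Suc n) else 1) * visit_weight w p"
proof -
  have steps: "set (p @ [s]) \<subseteq> {(1, 1), (1, -1)}" and len: "length p = n"
    using assms by (auto simp: positive_paths_def)
  have fst: "fst (sum_list p + s) = int (Suc n)"
    using fst_sum_list_steps[OF steps] len by simp
  have new: "sum_list p + s \<notin> visits p"
    using fst_vertices_bounds[of p "sum_list p + s"] steps fst len by (auto simp: visits_def)
  show ?thesis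
  proof (cases "snd (sum_list p + s) = 0")
    case True
    moreover have "sum_list p + s \<noteq> (0, 0)" using fst by (metis fst_conv of_nat_eq_0_iff nat.distinct(1))
    ultimately have "visits (p @ [s]) = insert (sum_list p + s) (visits p)"
      by (auto simp: visits_def vertices_snoc)
    with new fst True show ?thesis
      by (simp add: visit_weight_def finite_visits nat_add_distrib)
  next
    case False
    then have "visits (p @ [s]) = visits p"
      by (auto simp: visits_def vertices_snoc)
    with False show ?thesis by (simp add: visit_weight_def)
  qed
qed

lemma height_sum_eq_sum_paths: "height_sum w n h = (\<Sum>p\<in>paths_to n h. visit_weight w p)"
proof (induction w n h rule: height_sum.induct)
  case (1 w h)
  have "paths_to 0 h = (if h = 0 then {[]} else {})"
    by (auto simp: paths_to_def positive_paths_0)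
  moreover have "visits [] = {}" by (auto simp: visits_def vertices_def zero_prod_def)
  ultimately show ?case by (simp add: visit_weight_def)
next
  case (2 w n)
  have "(\<Sum>p\<in>paths_to (Suc n) 0. visit_weight w p)
      = (\<Sum>p\<in>paths_to n 1. visit_weight w (p @ [(1, -1)]))"
    by (simp add: paths_to_Suc_0 sum.reindex inj_on_def del: One_nat_def)
  also have "\<dots> = (\<Sum>p\<in>paths_to n 1. w (Suc n) * visit_weight w p)"
    by (intro sum.cong refl, subst visit_weight_snoc[where n = n])
       (auto simp: paths_to_def snoc_in_positive_paths)
  finally show ?case using 2 by (simp add: sum_distrib_left)
next
  case (3 w n h)
  have "(\<Sum>p\<in>paths_to (Suc n) (Suc h). visit_weight w p)
      = (\<Sum>p\<in>(\<lambda>p. p @ [(1, 1)]) ` paths_to n h. visit_weight w p)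
        + (\<Sum>p\<in>(\<lambda>p. p @ [(1, -1)]) ` paths_to n (Suc (Suc h)). visit_weight w p)"
    unfolding paths_to_Suc_Suc by (rule sum.union_disjoint) (auto simp: finite_paths_to)
  also have "\<dots> = (\<Sum>p\<in>paths_to n h. visit_weight w (p @ [(1, 1)]))
        + (\<Sum>p\<in>paths_to n (Suc (Suc h)). visit_weight w (p @ [(1, -1)]))"
    by (simp add: sum.reindex inj_on_def)
  also have "(\<Sum>p\<in>paths_to n h. visit_weight w (p @ [(1, 1)])) = (\<Sum>p\<in>paths_to n h. visit_weight w p)"
    by (intro sum.cong refl, subst visit_weight_snoc[where n = n])
       (auto simp: paths_to_def snoc_in_positive_paths)
  also have "(\<Sum>p\<in>paths_to n (Suc (Suc h)). visit_weight w (p @ [(1, -1)]))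
      = (\<Sum>p\<in>paths_to n (Suc (Suc h)). visit_weight w p)"
    by (intro sum.cong refl, subst visit_weight_snoc[where n = n])
       (auto simp: paths_to_def snoc_in_positive_paths)
  finally show ?case using 3 by simp
qed

lemma sum_positive_paths: "(\<Sum>p\<in>positive_paths n. visit_weight w p) = (\<Sum>h\<le>n. height_sum w n h)"
proof -
  have "positive_paths n = (\<Union>h\<le>n. paths_to n h)"
  proof (intro set_eqI iffI)
    fix p assume p: "p \<in> positive_paths n"
    then have "nat (snd (sum_list p)) \<le> n" "p \<in> paths_to n (nat (snd (sum_list p)))"
      using height_nonneg[OF p] height_le[OF p] by (auto simp: paths_to_def)
    then show "p \<in> (\<Union>h\<le>n. paths_to n h)" by blast
  qed (auto simp: paths_to_def)
  moreover have "(\<Sum>p\<in>(\<Union>h\<le>n. paths_to n h). visit_weight w p)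
      = (\<Sum>h\<le>n. \<Sum>p\<in>paths_to n h. visit_weight w p)"
    by (rule sum.UNION_disjoint) (auto simp: finite_paths_to paths_to_def finite_positive_paths)
  ultimately show ?thesis by (simp add: height_sum_eq_sum_paths)
qed

lemma dyck_paths_eq: "dyck_paths n = paths_to n 0"
  by (auto simp: dyck_paths_def paths_to_def)

section \<open>Constant weights, and weights vanishing at one abscissa\<close>

abbreviation N :: "real \<Rightarrow> nat \<Rightarrow> nat \<Rightarrow> real" where
  "N z \<equiv> height_sum (\<lambda>_. z)"

lemma visit_weight_const: "visit_weight (\<lambda>_. z) p = z ^ card (visits p)"
  by (simp add: visit_weight_def)

lemma T_eq: "T n z = (\<Sum>h\<le>n. N z n h)"
  by (simp add: T_def visit_weight_const flip: sum_positive_paths)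

lemma D_eq: "D n z = N z n 0"
  by (simp add: D_def visit_weight_const height_sum_eq_sum_paths dyck_paths_eq)

lemma visit_weight_avoiding:
  assumes "p \<in> positive_paths n" "0 < q"
  shows "visit_weight ((\<lambda>_. z)(q := 0)) p
    = (if (int q, 0) \<in> vertices p then 0 else z ^ card (visits p))"
proof (cases "(int q, 0) \<in> vertices p")
  case True
  then have "(int q, 0) \<in> visits p" using assms(2) by (simp add: visits_def)
  then have "visit_weight ((\<lambda>_. z)(q := 0)) p = 0"
    unfolding visit_weight_def by (intro prod_zero[OF finite_visits]) force
  with True show ?thesis by simp
next
  case False
  \<comment> \<open>On the axis a vertex is determined by its abscissa, so a visit at abscissa
    \<open>q\<close> could only be \<open>(int q, 0)\<close>.\<close>
  have "nat (fst v) \<noteq> q" if "v \<in> visits p" for v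
  proof
    assume *: "nat (fst v) = q"
    have "v \<in> vertices p" "snd v = 0" using that by (auto simp: visits_def)
    moreover have "0 \<le> fst v"
      using fst_vertices_bounds[of p v] assms(1) calculation by (auto simp: positive_paths_def)
    then have "v = (int q, 0)" using * calculation by (auto simp: prod_eq_iff)
    ultimately show False using False by simp
  qed
  then have "visit_weight ((\<lambda>_. z)(q := 0)) p = (\<Prod>v\<in>visits p. z)"
    unfolding visit_weight_def by (intro prod.cong) auto
  with False show ?thesis by simp
qed

lemma sum_visit_weight_avoiding:
  assumes "A \<subseteq> positive_paths n" "0 < q"
  shows "(\<Sum>p\<in>A. visit_weight ((\<lambda>_. z)(q := 0)) p)
    = (\<Sum>p\<in>{p \<in> A. (int q, 0) \<notin> vertices p}. z ^ card (visits p))"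
proof -
  have "finite A" using assms(1) finite_positive_paths by (rule finite_subset)
  have "(\<Sum>p\<in>A. visit_weight ((\<lambda>_. z)(q := 0)) p)
      = (\<Sum>p\<in>A. if (int q, 0) \<notin> vertices p then z ^ card (visits p) else 0)"
  proof (rule sum.cong[OF refl])
    fix p assume "p \<in> A"
    then have "p \<in> positive_paths n" using assms(1) by blast
    from visit_weight_avoiding[OF this assms(2), of z]
    show "visit_weight ((\<lambda>_. z)(q := 0)) p
        = (if (int q, 0) \<notin> vertices p then z ^ card (visits p) else 0)" by presburger
  qed
  also have "\<dots> = (\<Sum>p\<in>{p \<in> A. (int q, 0) \<notin> vertices p}. z ^ card (visits p))"
    by (rule sum.inter_filter[OF \<open>finite A\<close>, symmetric])
  finally show ?thesis .
qed

lemma T_avoiding_eq: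
  assumes "0 < q"
  shows "T_avoiding n z (int q) = (\<Sum>h\<le>n. height_sum ((\<lambda>_. z)(q := 0)) n h)"
  unfolding T_avoiding_def
  by (simp only: sum_visit_weight_avoiding[OF order_refl assms, symmetric] sum_positive_paths)

lemma D_avoiding_eq:
  assumes "0 < q"
  shows "D_avoiding n z (int q) = height_sum ((\<lambda>_. z)(q := 0)) n 0"
proof -
  have "dyck_paths n \<subseteq> positive_paths n" by (auto simp: dyck_paths_def)
  from sum_visit_weight_avoiding[OF this assms, of z] show ?thesis
    by (simp only: D_avoiding_def height_sum_eq_sum_paths dyck_paths_eq)
qed

section \<open>Decomposition at the avoided point\<close>

lemma height_sum_eq_0: "n < h \<Longrightarrow> height_sum w n h = 0"
  by (induction w n h rule: height_sum.induct) auto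

lemma height_sum_odd: "odd (n + h) \<Longrightarrow> height_sum w n h = 0"
  by (induction w n h rule: height_sum.induct) (auto elim: oddE)

lemma height_sum_cong:
  assumes "\<And>i. i \<le> n \<Longrightarrow> w i = w' i"
  shows "height_sum w n h = height_sum w' n h"
  using assms
proof (induction n arbitrary: h)
  case (Suc n)
  then have "height_sum w n i = height_sum w' n i" for i by simp
  moreover have "w (Suc n) = w' (Suc n)" by (simp add: Suc.prems)
  ultimately show ?case by (cases h) simp_all
qed simp

text \<open>Beyond \<open>q\<close> both sides obey the same linear recurrence with weight
  \<open>z\<close>. At \<open>k = 0\<close> they agree: at height 0 both vanish, and at positive
  heights the subtracted product is 0. No bijection that cuts paths at \<open>(q, 0)\<close> has to
  be built.\<close>

lemma height_sum_avoiding: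
  assumes "0 < q"
  shows "height_sum ((\<lambda>_. z)(q := 0)) (q + k) h = N z (q + k) h - N z q 0 * N z k h"
proof -
  define w where "w = (\<lambda>_. z)(q := 0)"
  have w: "w q = 0" "\<And>i. i \<noteq> q \<Longrightarrow> w i = z" by (auto simp: w_def)
  have "height_sum w (q + k) h = N z (q + k) h - N z q 0 * N z k h"
  proof (induction k arbitrary: h)
    case 0
    obtain r where q: "q = Suc r" using assms by (cases q) auto
    have "height_sum w r i = N z r i" for i
      by (rule height_sum_cong) (auto simp: q intro!: w(2))
    then show ?case using w(1) by (cases h) (auto simp: q)
  next
    case (Suc k)
    have "w (Suc (q + k)) = z" by (rule w(2)) simp
    then show ?case by (cases h) (simp_all add: Suc.IH right_diff_distrib distrib_left mult_ac)
  qed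
  then show ?thesis by (simp add: w_def)
qed

lemma T_avoiding_decomp:
  assumes "0 < q" "q \<le> n"
  shows "T_avoiding n z (int q) = T n z - D q z * T (n - q) z"
proof -
  have "height_sum ((\<lambda>_. z)(q := 0)) n h = N z n h - N z q 0 * N z (n - q) h" for h
    using height_sum_avoiding[OF assms(1), of z "n - q" h] assms(2) by simp
  then have "T_avoiding n z (int q) = T n z - D q z * (\<Sum>h\<le>n. N z (n - q) h)"
    by (simp add: T_avoiding_eq[OF assms(1)] T_eq D_eq sum_subtractf sum_distrib_left)
  also have "(\<Sum>h\<le>n. N z (n - q) h) = T (n - q) z"
    unfolding T_eq by (rule sum.mono_neutral_right) (auto simp: height_sum_eq_0)
  finally show ?thesis .
qed

lemma D_avoiding_decomp:
  assumes "0 < q" "q \<le> n"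
  shows "D_avoiding n z (int q) = D n z - D q z * D (n - q) z"
  using height_sum_avoiding[OF assms(1), of z "n - q" 0] assms
  by (simp add: D_avoiding_eq D_eq)

section \<open>Exact identities\<close>

lemma N_nonneg: "0 \<le> z \<Longrightarrow> 0 \<le> N z n h"
  by (induction "\<lambda>_::nat. z" n h rule: height_sum.induct) auto

lemma N_mono: "0 \<le> y \<Longrightarrow> y \<le> z \<Longrightarrow> N y n h \<le> N z n h"
proof (induction "\<lambda>_::nat. z" n h rule: height_sum.induct)
  case (2 n)
  then show ?case by (auto intro!: mult_mono N_nonneg)
qed (auto intro: add_mono)

lemma T_mono: "0 \<le> y \<Longrightarrow> y \<le> z \<Longrightarrow> T n y \<le> T n z"
  unfolding T_eq by (intro sum_mono N_mono)

text \<open>Both sides obey the recurrence for weight \<open>1\<close>: at height \<open>0\<close> the term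
  \<open>(z - 1) * N z n 1\<close> removes exactly the excess weight. Every weight is thereby compared with the
  Catalan case, without generating functions.\<close>

lemma N_one_eq: "N 1 n h = N z n h - (z - 1) * N z n (Suc (Suc h))"
  by (induction "\<lambda>_::nat. 1::real" n h rule: height_sum.induct) (auto simp: algebra_simps)

text \<open>Weight 2 turns the boundary rule into that of a walk symmetric about the axis, where
  height 0 is reached equally from 1 and from -1. Hence the sums count unrestricted walks ending at
  \<open>h\<close>.\<close>

lemma N_two_eq:
  "N 2 n h = (if even (n + h) then real (n choose ((n + h) div 2)) else 0)"
proof (induction "\<lambda>_::nat. 2::real" n h rule: height_sum.induct)
  case (2 n)
  show ?case
  proof (cases "even n")
    case False
    then obtain k where n: "n = Suc (2 * k)" by (auto elim: oddE)
    have "Suc (Suc (2 * k)) choose Suc k = 2 * (Suc (2 * k) choose Suc k)"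
      using binomial_symmetric[of k "Suc (2 * k)"] by simp
    with 2 n show ?thesis by simp
  qed (use 2 in simp)
next
  case (3 n h)
  show ?case
  proof (cases "even (n + h)")
    case True
    then obtain k where k: "n + h = 2 * k" by (elim evenE)
    have "(Suc n + Suc h) div 2 = Suc k" "(n + h) div 2 = k" "(n + Suc (Suc h)) div 2 = Suc k"
      using k by auto
    with 3 True show ?thesis by simp
  qed (use 3 in simp)
qed auto

text \<open>Sums over heights shifted by two arise both from the recurrence and from
  \<open>N_one_eq\<close>; this expresses them through \<open>T\<close>.\<close>

lemma T_eq_split: "T n z = N z n 0 + N z n 1 + (\<Sum>h\<le>n. N z n (Suc (Suc h)))"
  using sum.atMost_Suc_shift[of "N z n" n] sum.atMost_Suc_shift[of "\<lambda>h. N z n (Suc h)" n]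
  by (simp add: T_eq height_sum_eq_0)

text \<open>Every path extends in two ways, except that height 0 admits no down step and the step
  from 1 to 0 counts \<open>z\<close> instead of 1.\<close>

lemma T_Suc: "T (Suc n) z = 2 * T n z - N z n 0 + (z - 1) * N z n 1"
proof -
  have "T (Suc n) z = z * N z n 1 + T n z + (\<Sum>h\<le>n. N z n (Suc (Suc h)))"
    unfolding T_eq sum.atMost_Suc_shift by (simp add: sum.distrib)
  then show ?thesis using T_eq_split[of n z] by (simp add: algebra_simps)
qed

text \<open>\<open>N_one_eq\<close> summed over heights. It is used at \<open>z = 2\<close> to
  evaluate \<open>T n 1\<close>, at \<open>z = 0\<close> to bound \<open>T n 0\<close> from below,
  and for \<open>z > 2\<close> to express \<open>T\<close> through \<open>D\<close>.\<close>

lemma T_one_eq: "T n 1 = (2 - z) * T n z + (z - 1) * (N z n 0 + N z n 1)"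
proof -
  have "T n 1 = T n z - (z - 1) * (\<Sum>h\<le>n. N z n (Suc (Suc h)))"
    by (simp add: T_eq N_one_eq[of _ _ z] sum_subtractf sum_distrib_left)
  also have "(\<Sum>h\<le>n. N z n (Suc (Suc h))) = T n z - N z n 0 - N z n 1"
    using T_eq_split[of n z] by simp
  finally show ?thesis by (simp add: algebra_simps)
qed

text \<open>In terms of the unrestricted walks of \<open>N_two_eq\<close>: heights \<open>h\<close>
  and \<open>-h\<close> are equinumerous, so doubling the sum over nonnegative heights counts
  everything once and height 0 twice.\<close>

lemma T_two_eq: "2 * T n 2 = 2 ^ n + D n 2"
proof (induction n)
  case 0
  show ?case by (simp add: T_eq D_eq)
next
  case (Suc n)
  then show ?case by (simp add: T_Suc D_eq)
qed

lemma D_two_eq: "D (2 * m) 2 = real ((2 * m) choose m)"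
  by (simp add: D_eq N_two_eq)

text \<open>\<open>N_one_eq\<close> at weight 2 gives the Catalan number as a difference of two
  neighbouring binomial coefficients; absorption relates the second to the first.\<close>

lemma D_one_eq: "D (2 * m) 1 = real ((2 * m) choose m) / real (Suc m)"
proof -
  have "Suc m * ((2 * m) choose Suc m) = (2 * m - m) * ((2 * m) choose m)"
    unfolding binomial_absorb_comp binomial_absorption ..
  then have "Suc m * ((2 * m) choose Suc m) = m * ((2 * m) choose m)"
    by simp
  then have "real (Suc m) * real ((2 * m) choose Suc m) = real m * real ((2 * m) choose m)"
    by (metis of_nat_mult)
  moreover have "D (2 * m) 1 = real ((2 * m) choose m) - real ((2 * m) choose Suc m)"
    by (simp add: D_eq N_one_eq[of _ _ 2] N_two_eq)
  ultimately have "D (2 * m) 1 * real (Suc m)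
      = real (Suc m) * real ((2 * m) choose m) - real m * real ((2 * m) choose m)"
    by (simp only: right_diff_distrib mult.commute[of _ "real (Suc m)"])
  then have "D (2 * m) 1 * real (Suc m) = real ((2 * m) choose m)"
    by (simp add: algebra_simps)
  then show ?thesis by (intro eq_divide_imp) simp_all
qed

text \<open>The recurrence at height 1 eliminates the height-two term of \<open>N_one_eq\<close>.
  Keeping the factor \<open>z - 1\<close> undivided leaves the identity valid for every
  \<open>z\<close>.\<close>

lemma height_one_rec: "(z - 1) * N z (Suc n) 1 = z * D n z - D n 1"
  by (simp add: D_eq N_one_eq[of n 0 z] algebra_simps)

lemma D_Suc_Suc: "D (Suc (Suc n)) z = z * N z (Suc n) 1"
  by (simp add: D_eq)

lemma D_rec: "(z - 1) * D (Suc (Suc n)) z = z\<^sup>2 * D n z - z * D n 1"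
proof -
  have "(z - 1) * D (Suc (Suc n)) z = z * ((z - 1) * N z (Suc n) 1)"
    by (simp only: D_Suc_Suc mult_ac)
  then show ?thesis unfolding height_one_rec by (simp add: algebra_simps power2_eq_square)
qed


section \<open>Growth for weights at most 2\<close>

lemma D_nonneg: "0 \<le> z \<Longrightarrow> 0 \<le> D n z"
  by (simp add: D_eq N_nonneg)

lemma D_mono: "0 \<le> y \<Longrightarrow> y \<le> z \<Longrightarrow> D n y \<le> D n z"
  by (simp add: D_eq N_mono)

lemma D_le_T: "0 \<le> z \<Longrightarrow> D n z \<le> T n z"
  unfolding D_eq T_eq by (rule member_le_sum) (auto intro: N_nonneg)

lemma T_le_power: "0 \<le> z \<Longrightarrow> z \<le> 2 \<Longrightarrow> T n z \<le> 2 ^ n"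
  using T_two_eq[of n] D_le_T[of 2 n] T_mono[of z 2 n] by simp

lemma D_le_power: "0 \<le> z \<Longrightarrow> z \<le> 2 \<Longrightarrow> D (2 * m) z \<le> 4 ^ m"
  using T_le_power[of z "2 * m"] D_le_T[of z "2 * m"] by (simp add: power_mult)

section \<open>Elementary bounds for central binomial coefficients and Catalan numbers\<close>

lemma D_one_eq_D_two: "D (2 * m) 1 = D (2 * m) 2 / (real m + 1)"
  by (simp add: D_one_eq D_two_eq add.commute)

lemma D_two_Suc: "D (2 * Suc m) 2 = D (2 * m) 2 * (4 * real m + 2) / (real m + 1)"
proof -
  have "D (2 * Suc m) 2 = 4 * D (2 * m) 2 - 2 * (D (2 * m) 2 / (real m + 1))"
    using D_rec[of 2 "2 * m"] by (simp flip: D_one_eq_D_two)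
  then show ?thesis by (simp add: field_simps)
qed

lemma D_one_Suc_le: "D (2 * Suc m) 1 \<le> 4 * D (2 * m) 1"
proof -
  have "D (2 * Suc m) 1 = D (2 * m) 1 * ((4 * real m + 2) / (real m + 2))"
    unfolding D_one_eq_D_two D_two_Suc by (simp add: field_simps)
  also have "\<dots> \<le> D (2 * m) 1 * 4"
    by (intro mult_left_mono D_nonneg) (auto simp: field_simps)
  finally show ?thesis by simp
qed

text \<open>Squaring makes the bound inductive without Stirling's formula: the left side grows by at
  most 16 per step, since (2m+1)(2m+3) \<le> (2m+2)^2.\<close>

lemma D_two_sq_upper: "(2 * real m + 1) * (D (2 * m) 2)\<^sup>2 \<le> 16 ^ m"
proof (induction m)
  case 0
  show ?case by (simp add: D_eq)
next
  case (Suc m)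
  define b where "b = D (2 * m) 2"
  have "(2 * real (Suc m) + 1) * (D (2 * Suc m) 2)\<^sup>2
      = 4 * (2 * real m + 1) * b\<^sup>2 * ((2 * real m + 3) * (2 * real m + 1) / (real m + 1)\<^sup>2)"
    unfolding D_two_Suc b_def[symmetric] by (simp add: field_simps power2_eq_square)
  also have "\<dots> \<le> 4 * (2 * real m + 1) * b\<^sup>2 * 4"
  proof (rule mult_left_mono)
    show "(2 * real m + 3) * (2 * real m + 1) / (real m + 1)\<^sup>2 \<le> 4"
      by (subst pos_divide_le_eq, simp) (simp add: power2_eq_square algebra_simps)
  qed simp
  also have "\<dots> = 16 * ((2 * real m + 1) * b\<^sup>2)" by simp
  also have "\<dots> \<le> 16 ^ Suc m" using Suc.IH unfolding b_def by simp
  finally show ?case .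
qed

text \<open>The companion induction rests on 4m(m+1) \<le> (2m+1)^2; equality holds at
  \<open>m = 1\<close>.\<close>

lemma D_two_sq_lower: "1 \<le> m \<Longrightarrow> 16 ^ m \<le> 4 * real m * (D (2 * m) 2)\<^sup>2"
proof (induction m rule: nat_induct_at_least)
  case base
  show ?case using D_two_eq[of 1] by simp
next
  case (Suc m)
  define b where "b = D (2 * m) 2"
  have "16 ^ Suc m \<le> 4 * b\<^sup>2 * (16 * real m)" using Suc.IH by (simp add: b_def)
  also have "\<dots> \<le> 4 * b\<^sup>2 * ((4 * real m + 2)\<^sup>2 / (real m + 1))"
  proof (rule mult_left_mono)
    show "16 * real m \<le> (4 * real m + 2)\<^sup>2 / (real m + 1)"
      by (subst pos_le_divide_eq) (auto simp: power2_eq_square algebra_simps)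
  qed simp
  also have "4 * b\<^sup>2 * ((4 * real m + 2)\<^sup>2 / (real m + 1))
      = 4 * (real m + 1) * (b * (4 * real m + 2) / (real m + 1))\<^sup>2"
  proof -
    have "4 * b\<^sup>2 * (x\<^sup>2 / y) = 4 * y * (b * x / y)\<^sup>2" if "y \<noteq> 0" for x y
      using that by (simp add: power2_eq_square)
    then show ?thesis by (metis of_nat_neq_0 of_nat_Suc add.commute)
  qed
  also have "\<dots> = 4 * real (Suc m) * (D (2 * Suc m) 2)\<^sup>2"
    unfolding D_two_Suc b_def[symmetric] by (simp add: add.commute)
  finally show ?case .
qed

lemma D_two_upper:
  assumes "1 \<le> m"
  shows "D (2 * m) 2 \<le> 4 ^ m / real m powr (1 / 2)"
proof -
  have "(D (2 * m) 2 * sqrt (real m))\<^sup>2 \<le> (2 * real m + 1) * (D (2 * m) 2)\<^sup>2"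
    by (simp add: power_mult_distrib mult.commute[of _ "real m"] mult_right_mono)
  also have "\<dots> \<le> (4 ^ m)\<^sup>2"
    using D_two_sq_upper[of m] by (simp add: power2_eq_square flip: power_mult_distrib)
  finally have "D (2 * m) 2 * sqrt (real m) \<le> 4 ^ m" by (rule power2_le_imp_le) simp
  with assms show ?thesis by (simp add: powr_half_sqrt field_simps)
qed

lemma D_two_lower:
  assumes "1 \<le> m"
  shows "(1 / 2) * (4 ^ m / real m powr (1 / 2)) \<le> D (2 * m) 2"
proof -
  have "(4 ^ m)\<^sup>2 = (16 :: real) ^ m"
    by (simp add: power2_eq_square flip: power_mult_distrib)
  also have "\<dots> \<le> (2 * D (2 * m) 2 * sqrt (real m))\<^sup>2"
    using D_two_sq_lower[OF assms] by (simp add: power_mult_distrib mult_ac)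
  finally have "4 ^ m \<le> 2 * D (2 * m) 2 * sqrt (real m)"
    by (rule power2_le_imp_le) (simp add: D_nonneg)
  with assms show ?thesis by (simp add: powr_half_sqrt field_simps)
qed

lemma powr_three_halves: "0 \<le> x \<Longrightarrow> x powr (3 / 2) = x * x powr (1 / 2)" for x :: real
  using powr_add[of x 1 "1 / 2"] by simp

lemma D_one_upper:
  assumes "1 \<le> m"
  shows "D (2 * m) 1 \<le> 4 ^ m / real m powr (3 / 2)"
proof -
  have "D (2 * m) 1 \<le> D (2 * m) 2 / real m"
    unfolding D_one_eq_D_two by (rule divide_left_mono) (use assms in \<open>auto simp: D_nonneg\<close>)
  also have "\<dots> \<le> (4 ^ m / real m powr (1 / 2)) / real m"
    by (intro divide_right_mono D_two_upper assms) simp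
  finally show ?thesis by (simp add: powr_three_halves mult.commute)
qed

lemma D_one_lower:
  assumes "1 \<le> m"
  shows "(1 / 4) * (4 ^ m / real m powr (3 / 2)) \<le> D (2 * m) 1"
proof -
  have "(1 / 4) * (4 ^ m / real m powr (3 / 2)) = ((1 / 2) * (4 ^ m / real m powr (1 / 2))) / (2 * real m)"
    by (simp add: powr_three_halves mult_ac)
  also have "\<dots> \<le> D (2 * m) 2 / (2 * real m)"
    by (intro divide_right_mono D_two_lower assms) simp
  also have "\<dots> \<le> D (2 * m) 1"
    unfolding D_one_eq_D_two by (rule divide_left_mono) (use assms in \<open>auto simp: D_nonneg\<close>)
  finally show ?thesis .
qed

text \<open>For \<open>1 < z < 2\<close> the recurrence for \<open>D\<close> is unstable (its multiplier \<open>l\<close> exceeds \<open>4\<close>), so it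
  is run backwards, starting from the crude bound \<open>4 ^ (m + j)\<close>.\<close>

lemma D_upper_aux:
  assumes "1 < z" "z < 2"
  obtains K where "0 < K" "\<And>m. D (2 * m) z \<le> K * D (2 * m) 1"
proof -
  define l where "l = z\<^sup>2 / (z - 1)"
  \<comment> \<open>z^2 - 4(z - 1) = (z - 2)^2, so this is the claim \<open>4 < l\<close> in
    disguise.\<close>
  have "0 < (z - 2)\<^sup>2" using assms by simp
  then have l: "4 < l" using assms by (simp add: l_def field_simps power2_eq_square)
  \<comment> \<open>\<open>K\<close> is the fixed point of K = 1/z + 4K/l, so that a backward step
    reproduces the same constant.\<close>
  define K where "K = l / (z * (l - 4))"
  have K: "0 < K" using l assms by (simp add: K_def)
  have fix_K: "K = 1 / z + 4 * K / l"
    using l assms by (simp add: K_def field_simps)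
  have backward: "D (2 * m) z = D (2 * m) 1 / z + D (2 * Suc m) z / l" for m
    using D_rec[of z "2 * m"] assms by (simp add: l_def field_simps power2_eq_square)
  have bound: "D (2 * m) z \<le> K * D (2 * m) 1 + 4 ^ m * (4 / l) ^ j" for m j
  proof (induction j arbitrary: m)
    case 0
    have "0 \<le> K * D (2 * m) 1" using K by (simp add: D_nonneg)
    then show ?case using D_le_power[of z m] assms by simp
  next
    case (Suc j)
    have "D (2 * m) z \<le> D (2 * m) 1 / z + (K * D (2 * Suc m) 1 + 4 ^ Suc m * (4 / l) ^ j) / l"
      unfolding backward[of m] using Suc.IH[of "Suc m"] l by (intro add_left_mono divide_right_mono) auto
    also have "\<dots> \<le> D (2 * m) 1 / z + (K * (4 * D (2 * m) 1) + 4 ^ Suc m * (4 / l) ^ j) / l"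
      using K l D_one_Suc_le
      by (intro add_left_mono add_right_mono divide_right_mono mult_left_mono) auto
    also have "\<dots> = (1 / z + 4 * K / l) * D (2 * m) 1 + 4 ^ m * (4 / l) ^ Suc j"
      using l assms by (simp add: field_simps)
    finally show ?case unfolding fix_K[symmetric] .
  qed
  \<comment> \<open>As \<open>j\<close> grows, the error inherited from the crude starting bound
    vanishes because \<open>4 < l\<close>.\<close>
  have "D (2 * m) z \<le> K * D (2 * m) 1" for m
  proof (rule LIMSEQ_le_const)
    have "(\<lambda>j. (4 / l) ^ j) \<longlonglongrightarrow> 0" using l by (intro LIMSEQ_power_zero) auto
    from tendsto_add[OF tendsto_const tendsto_mult[OF tendsto_const this]]
    show "(\<lambda>j. K * D (2 * m) 1 + 4 ^ m * (4 / l) ^ j) \<longlonglongrightarrow> K * D (2 * m) 1" by simp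
  qed (use bound in auto)
  with K that show thesis by blast
qed

lemma D_upper:
  assumes "0 < z" "z < 2"
  obtains K where "0 < K" "\<And>m. D (2 * m) z \<le> K * D (2 * m) 1"
proof -
  \<comment> \<open>Monotonicity in the weight covers \<open>z \<le> 1\<close>; 3/2 is just a
    convenient point between 1 and 2.\<close>
  have "1 < max z (3 / 2)" "max z (3 / 2) < 2" using assms by auto
  from D_upper_aux[OF this] obtain K
    where K: "0 < K" "\<And>m. D (2 * m) (max z (3 / 2)) \<le> K * D (2 * m) 1" by blast
  have "D (2 * m) z \<le> K * D (2 * m) 1" for m
    using D_mono[of z "max z (3 / 2)" "2 * m"] K(2)[of m] assms by simp
  with K(1) that show thesis by blast
qed

lemma D_lower:
  assumes "0 \<le> z" "1 \<le> m"
  shows "z / 4 * D (2 * m) 1 \<le> D (2 * m) z"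
proof -
  obtain k where m: "m = Suc k" using assms(2) by (cases m) auto
  define x where "x = N z (Suc (2 * k)) 1"
  \<comment> \<open>Weight 0 forbids returns to the axis, and deleting the first up step leaves an
    arbitrary Dyck path when the final height is 1.\<close>
  have "D (2 * k) 1 = N 0 (Suc (2 * k)) 1"
    using height_one_rec[of 0 "2 * k"] by simp
  then have "D (2 * m) 1 \<le> 4 * x"
    using D_one_Suc_le[of k] N_mono[of 0 z "Suc (2 * k)" 1] assms(1) unfolding m x_def by linarith
  then have "z * D (2 * m) 1 \<le> z * (4 * x)"
    using assms(1) by (rule mult_left_mono)
  moreover have "D (2 * m) z = z * x"
    by (simp only: x_def m mult_Suc_right add_2_eq_Suc D_Suc_Suc)
  ultimately show ?thesis by simp
qed

section \<open>Lower bounds for \<open>T\<close>\<close>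

lemma T_one_lower: "2 ^ n \<le> (real n + 1) * T n 1"
proof -
  have T1: "T n 1 = real (n choose (n div 2))"
  proof (cases "even n")
    case True
    then show ?thesis using T_one_eq[of n 2] by (simp add: N_two_eq)
  next
    case False
    then obtain k where n: "n = Suc (2 * k)" by (auto elim: oddE)
    then have "T n 1 = real (Suc (2 * k) choose Suc k)"
      using T_one_eq[of n 2] by (simp add: N_two_eq)
    also have "Suc (2 * k) choose Suc k = Suc (2 * k) choose k"
      using binomial_symmetric[of k "Suc (2 * k)"] by simp
    finally show ?thesis by (simp add: n)
  qed
  \<comment> \<open>\<open>T n 1\<close> is the largest of the \<open>n + 1\<close> coefficients in
    a row with sum \<open>2 ^ n\<close>, hence at least their average.\<close>
  have "2 ^ n = (\<Sum>k\<le>n. n choose k)" by (simp add: choose_row_sum)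
  also have "\<dots> \<le> (\<Sum>k\<le>n. n choose (n div 2))" by (intro sum_mono binomial_maximum)
  finally have "(2::nat) ^ n \<le> Suc n * (n choose (n div 2))" by simp
  then have "real (2 ^ n) \<le> real (Suc n * (n choose (n div 2)))" by (rule of_nat_mono)
  then show ?thesis by (simp add: T1 algebra_simps)
qed

lemma T_lower:
  assumes "0 \<le> z" "1 \<le> n"
  shows "2 ^ n / (4 * real n) \<le> T n z"
proof -
  \<comment> \<open>At \<open>z = 0\<close> the boundary terms of \<open>T_one_eq\<close> enter
    negatively and are dropped. This carries the bound from weight 1 to all nonnegative
    weights.\<close>
  have "T n 1 \<le> 2 * T n 0"
    using T_one_eq[of n 0] N_nonneg[of 0 n 0] N_nonneg[of 0 n 1] by simp
  then have *: "T n 1 \<le> 2 * T n z" using T_mono[of 0 z n] assms(1) by simp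
  have "2 ^ n \<le> (real n + 1) * T n 1" by (rule T_one_lower)
  also have "\<dots> \<le> (2 * real n) * (2 * T n z)"
    using * assms T_mono[of 0 1 n] D_le_T[of 0 n] D_nonneg[of 0 n] by (intro mult_mono) auto
  finally show ?thesis using assms by (simp add: field_simps)
qed

text \<open>The exponent is \<open>3/2\<close> for \<open>z < 2\<close> and \<open>1/2\<close> for \<open>z = 2\<close>. For \<open>z < 2\<close> the bound on \<open>T\<close> is
  not sharp, but all that matters below is that its exponent is smaller than that of \<open>D\<close>.\<close>

lemma growth_le_two:
  assumes "0 < z" "z \<le> 2"
  obtains s A B C :: real where "0 < s" "0 < A" "0 < B" "0 < C"
    "\<And>m. 1 \<le> m \<Longrightarrow> A * (4 ^ m / real m powr s) \<le> D (2 * m) z"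
    "\<And>m. 1 \<le> m \<Longrightarrow> D (2 * m) z \<le> B * (4 ^ m / real m powr s)"
    "\<And>n. 1 \<le> n \<Longrightarrow> C * (2 ^ n / real n powr (s - 1 / 2)) \<le> T n z"
proof (cases "z = 2")
  case True
  show thesis
  proof (rule that[of "1 / 2" "1 / 2" 1 "1 / 2"])
    fix n :: nat assume "1 \<le> n"
    then show "1 / 2 * (2 ^ n / real n powr (1 / 2 - 1 / 2)) \<le> T n z"
      using T_two_eq[of n] D_nonneg[of 2 n] by (simp add: True)
  qed (use D_two_lower D_two_upper True in auto)
next
  case False
  then obtain K where K: "0 < K" "\<And>m. D (2 * m) z \<le> K * D (2 * m) 1"
    using D_upper assms by (metis less_le)
  show thesis
  proof (rule that[of "3 / 2" "z / 4 * (1 / 4)" K "1 / 4"])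
    fix m :: nat assume m: "1 \<le> m"
    have "z / 4 * (1 / 4 * (4 ^ m / real m powr (3 / 2))) \<le> z / 4 * D (2 * m) 1"
      using assms by (intro mult_left_mono D_one_lower m) auto
    also have "\<dots> \<le> D (2 * m) z" using assms m by (intro D_lower) auto
    finally show "z / 4 * (1 / 4) * (4 ^ m / real m powr (3 / 2)) \<le> D (2 * m) z"
      by (simp only: mult.assoc)
    have "K * D (2 * m) 1 \<le> K * (4 ^ m / real m powr (3 / 2))"
      using K(1) by (intro mult_left_mono D_one_upper m) auto
    with K(2) show "D (2 * m) z \<le> K * (4 ^ m / real m powr (3 / 2))" by (rule order_trans)
  next
    fix n :: nat assume n: "1 \<le> n"
    then show "1 / 4 * (2 ^ n / real n powr (3 / 2 - 1 / 2)) \<le> T n z"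
      using T_lower[of z n] assms by simp
  qed (use assms K in auto)
qed

lemma T_pos: "0 < z \<Longrightarrow> 0 < T n z"
proof (cases "n = 0")
  case False
  moreover assume "0 < z"
  ultimately have "2 ^ n / (4 * real n) \<le> T n z" by (intro T_lower) auto
  moreover have "0 < 2 ^ n / (4 * real n)" using False by simp
  ultimately show ?thesis by linarith
qed (simp add: T_eq)

lemma D_pos:
  assumes "0 < z"
  shows "0 < D (2 * m) z"
proof (cases "m = 0")
  case False
  then have "z / 4 * D (2 * m) 1 \<le> D (2 * m) z" using assms by (intro D_lower) auto
  moreover have "0 < z / 4 * D (2 * m) 1" using assms by (simp add: D_one_eq)
  ultimately show ?thesis by linarith
qed (simp add: D_eq)

section \<open>Growth for weights greater than 2\<close>

text \<open>The weights \<open>z\<close> and \<open>w = z / (z - 1)\<close> satisfy \<open>z\<^sup>2 / (z - 1) = w\<^sup>2 / (w - 1)\<close>, so the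
  recurrences of \<open>D\<close> for both have the same multiplier and their inhomogeneities cancel.\<close>

lemma D_conjugate:
  assumes "z \<noteq> 1" "z \<noteq> 0" "w = z / (z - 1)" "l = z\<^sup>2 / (z - 1)"
  shows "z * D (2 * m) z - w * D (2 * m) w = (z - w) * l ^ m"
proof (induction m)
  case 0
  show ?case by (simp add: D_eq)
next
  case (Suc m)
  define x y c where "x = D (2 * m) z" and "y = D (2 * m) w" and "c = D (2 * m) 1"
  have w: "w - 1 = 1 / (z - 1)" "w\<^sup>2 = l / (z - 1)"
    using assms(1) by (simp add: assms(3) field_simps) (simp add: assms(3,4) power2_eq_square)
  have "(z - 1) * D (2 * Suc m) z = z\<^sup>2 * x - z * c"
    using D_rec[of z "2 * m"] by (simp add: x_def c_def)
  then have "D (2 * Suc m) z = (z\<^sup>2 * x - z * c) / (z - 1)"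
    using assms(1) by (simp add: eq_divide_eq mult.commute)
  then have 1: "D (2 * Suc m) z = l * x - w * c"
    by (simp add: assms(3,4) diff_divide_distrib)
  have "(w - 1) * D (2 * Suc m) w = w\<^sup>2 * y - w * c"
    using D_rec[of w "2 * m"] by (simp add: y_def c_def)
  then have "D (2 * Suc m) w / (z - 1) = (l * y - z * c) / (z - 1)"
    unfolding w using assms by (simp add: diff_divide_distrib)
  then have 2: "D (2 * Suc m) w = l * y - z * c"
    using assms by simp
  have "z * D (2 * Suc m) z - w * D (2 * Suc m) w = l * (z * x - w * y)"
    unfolding 1 2 by (simp add: algebra_simps)
  then show ?case using Suc.IH by (simp add: x_def y_def)
qed

context
  fixes z l :: real
  assumes z: "2 < z" and l_eq: "l = z\<^sup>2 / (z - 1)"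
begin

lemma growth_rate_gt_4: "4 < l"
proof -
  have "0 < (z - 2)\<^sup>2" using z by simp
  then show ?thesis using z by (simp add: l_eq field_simps power2_eq_square)
qed

text \<open>Removes the remainders in the asymptotics below: \<open>D\<close> at the conjugate
  weight and \<open>T\<close> at weight 1.\<close>

lemma bounded_by_4_power_tendsto_0:
  assumes "\<And>m. 0 \<le> f m" "\<And>m. f m \<le> B * 4 ^ m"
  shows "(\<lambda>m. f m / l ^ m) \<longlonglongrightarrow> 0"
proof (rule tendsto_sandwich[OF _ _ tendsto_const])
  show "\<forall>\<^sub>F m in sequentially. f m / l ^ m \<le> B * (4 / l) ^ m"
    using assms growth_rate_gt_4 by (intro always_eventually) (auto simp: power_divide divide_right_mono)
  have "(\<lambda>m. (4 / l) ^ m) \<longlonglongrightarrow> 0"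
    using growth_rate_gt_4 by (intro LIMSEQ_power_zero) auto
  from tendsto_mult[OF tendsto_const this]
  show "(\<lambda>m. B * (4 / l) ^ m) \<longlonglongrightarrow> 0" by simp
qed (use assms growth_rate_gt_4 in auto)

text \<open>For \<open>z > 2\<close> the conjugate weight \<open>w\<close> is at most 2, so its sum
  is negligible against \<open>l ^ m\<close> and \<open>D_conjugate\<close> leaves the constant (z -
  w)/z.\<close>

lemma D_asymp_gt_2: "(\<lambda>m. D (2 * m) z / l ^ m) \<longlonglongrightarrow> (z - 2) / (z - 1)"
proof -
  define w where "w = z / (z - 1)"
  have w: "0 \<le> w" "w \<le> 2" using z by (auto simp: w_def field_simps)
  have "D (2 * m) z / l ^ m = (z - w) / z + w / z * (D (2 * m) w / l ^ m)" for m
  proof -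
    have "z * D (2 * m) z - w * D (2 * m) w = (z - w) * l ^ m"
      using z l_eq by (intro D_conjugate) (auto simp: w_def)
    then have "z * D (2 * m) z = (z - w) * l ^ m + w * D (2 * m) w" by linarith
    then have "D (2 * m) z = ((z - w) * l ^ m + w * D (2 * m) w) / z"
      using z by (simp add: eq_divide_eq mult.commute)
    then show ?thesis using growth_rate_gt_4 by (simp add: add_divide_distrib)
  qed
  moreover have "(\<lambda>m. D (2 * m) w / l ^ m) \<longlonglongrightarrow> 0"
    using w by (intro bounded_by_4_power_tendsto_0[where B = 1]) (auto simp: D_nonneg D_le_power)
  then have "(\<lambda>m. (z - w) / z + w / z * (D (2 * m) w / l ^ m)) \<longlonglongrightarrow> (z - w) / z + w / z * 0"
    by (intro tendsto_intros)
  moreover have "(z - w) / z = (z - 2) / (z - 1)"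
    using z by (simp add: w_def field_simps)
  ultimately show ?thesis by simp
qed

text \<open>\<open>T_one_eq\<close> is solved for \<open>T\<close>: the height-one term vanishes by
  parity and the weight-one term is at most \<open>4 ^ m\<close>.\<close>

lemma T_even_asymp_gt_2: "(\<lambda>m. T (2 * m) z / l ^ m) \<longlonglongrightarrow> 1"
proof -
  have "T (2 * m) z / l ^ m = (z - 1) / (z - 2) * (D (2 * m) z / l ^ m) - 1 / (z - 2) * (T (2 * m) 1 / l ^ m)" for m
  proof -
    have "N z (2 * m) 1 = 0" by (rule height_sum_odd) simp
    then have "(z - 2) * T (2 * m) z = (z - 1) * D (2 * m) z - T (2 * m) 1"
      using T_one_eq[of "2 * m" z] by (simp add: D_eq algebra_simps)
    then have "T (2 * m) z = ((z - 1) * D (2 * m) z - T (2 * m) 1) / (z - 2)"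
      using z by (simp add: field_simps)
    moreover have "(k * x - y) / r / q = k / r * (x / q) - 1 / r * (y / q)" for k x y r q :: real
      by (simp add: diff_divide_distrib)
    ultimately show ?thesis by simp
  qed
  moreover have "(\<lambda>m. T (2 * m) 1 / l ^ m) \<longlonglongrightarrow> 0"
    using T_le_power[of 1 "2 * m" for m] T_pos[of 1 "2 * m" for m]
    by (intro bounded_by_4_power_tendsto_0[where B = 1]) (auto simp: power_mult less_imp_le)
  then have "(\<lambda>m. (z - 1) / (z - 2) * (D (2 * m) z / l ^ m) - 1 / (z - 2) * (T (2 * m) 1 / l ^ m))
      \<longlonglongrightarrow> (z - 1) / (z - 2) * ((z - 2) / (z - 1)) - 1 / (z - 2) * 0"
    by (intro tendsto_intros D_asymp_gt_2)
  moreover have "(z - 1) / (z - 2) * ((z - 2) / (z - 1)) - 1 / (z - 2) * 0 = 1" using z by simp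
  ultimately show ?thesis by simp
qed

lemma T_odd_asymp_gt_2: "(\<lambda>m. T (Suc (2 * m)) z / l ^ m) \<longlonglongrightarrow> z / (z - 1)"
proof -
  have "T (Suc (2 * m)) z / l ^ m = 2 * (T (2 * m) z / l ^ m) - D (2 * m) z / l ^ m" for m
  proof -
    have "N z (2 * m) 1 = 0" by (rule height_sum_odd) simp
    then have "T (Suc (2 * m)) z = 2 * T (2 * m) z - D (2 * m) z"
      using T_Suc[of "2 * m" z] by (simp add: D_eq)
    then show ?thesis by (simp add: diff_divide_distrib)
  qed
  moreover have "(\<lambda>m. 2 * (T (2 * m) z / l ^ m) - D (2 * m) z / l ^ m) \<longlonglongrightarrow> 2 * 1 - (z - 2) / (z - 1)"
    by (intro tendsto_intros T_even_asymp_gt_2 D_asymp_gt_2)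
  moreover have "2 * 1 - (z - 2) / (z - 1) = z / (z - 1)"
    using z by (simp add: field_simps)
  ultimately show ?thesis by simp
qed

end

section \<open>Limits of the ratios\<close>

text \<open>The powers of \<open>l\<close> cancel, and the two normalised values of \<open>g\<close>
  share the nonzero limit \<open>M\<close>, so only the limit of \<open>f\<close> survives.\<close>

lemma split_ratio_tendsto:
  fixes f g :: "nat \<Rightarrow> real"
  assumes f: "(\<lambda>m. f m / l ^ m) \<longlonglongrightarrow> L" and g: "(\<lambda>m. g m / l ^ m) \<longlonglongrightarrow> M"
    and "M \<noteq> 0" "l \<noteq> 0"
    and p: "filterlim p at_top sequentially" and r: "filterlim (\<lambda>m. m - p m) at_top sequentially"
  shows "(\<lambda>m. f (p m) * g (m - p m) / g m) \<longlonglongrightarrow> L"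
proof -
  have "(\<lambda>m. (f (p m) / l ^ p m) * (g (m - p m) / l ^ (m - p m)) / (g m / l ^ m)) \<longlonglongrightarrow> L * M / M"
    using \<open>M \<noteq> 0\<close> by (intro tendsto_divide tendsto_mult g
        filterlim_compose[OF f p] filterlim_compose[OF g r])
  moreover have "\<forall>\<^sub>F m in sequentially.
    (f (p m) / l ^ p m) * (g (m - p m) / l ^ (m - p m)) / (g m / l ^ m) = f (p m) * g (m - p m) / g m"
    using eventually_compose_filterlim[OF eventually_gt_at_top[of 0] r]
  proof eventually_elim
    case (elim m)
    \<comment> \<open>Positivity of the truncated difference gives \<open>p m < m\<close>, so the
      exponents really add up to \<open>m\<close>.\<close>
    then have "l ^ p m * l ^ (m - p m) = l ^ m" by (simp flip: power_add)
    then show ?case using \<open>l \<noteq> 0\<close> by (simp add: field_simps)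
  qed
  ultimately show ?thesis
    using \<open>M \<noteq> 0\<close> by (auto elim: Lim_transform_eventually)
qed

text \<open>For \<open>z > 2\<close> the normalised \<open>T\<close> has different limits along even
  and odd lengths, but the ratios have the same limit along both.\<close>

lemma tendsto_even_odd:
  fixes f :: "nat \<Rightarrow> 'a::topological_space"
  assumes "(\<lambda>m. f (2 * m)) \<longlonglongrightarrow> L" "(\<lambda>m. f (Suc (2 * m))) \<longlonglongrightarrow> L"
  shows "f \<longlonglongrightarrow> L"
proof (rule topological_tendstoI)
  fix S assume S: "open S" "L \<in> S"
  obtain A where A: "\<And>m. m \<ge> A \<Longrightarrow> f (2 * m) \<in> S"
    using topological_tendstoD[OF assms(1) S] by (auto simp: eventually_sequentially)
  obtain B where B: "\<And>m. m \<ge> B \<Longrightarrow> f (Suc (2 * m)) \<in> S"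
    using topological_tendstoD[OF assms(2) S] by (auto simp: eventually_sequentially)
  have "f n \<in> S" if "n \<ge> 2 * A + 2 * B + 1" for n
  proof (cases "even n")
    case True
    then show ?thesis using A[of "n div 2"] that by auto
  next
    case False
    then show ?thesis using B[of "n div 2"] that by (auto elim!: oddE)
  qed
  then show "\<forall>\<^sub>F n in sequentially. f n \<in> S" by (auto simp: eventually_sequentially)
qed

lemma tendsto_even_filter_iff:
  "(f \<longlongrightarrow> L) (inf sequentially (principal {n. even n})) \<longleftrightarrow> (\<lambda>m::nat. f (2 * m)) \<longlonglongrightarrow> L"
proof -
  have "inf sequentially (principal {n::nat. even n}) = filtermap (\<lambda>m. 2 * m) sequentially"
  proof (rule filter_eqI)
    fix P :: "nat \<Rightarrow> bool"
    show "eventually P (inf sequentially (principal {n. even n}))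
        \<longleftrightarrow> eventually P (filtermap (\<lambda>m. 2 * m) sequentially)"
    proof
      assume "eventually P (inf sequentially (principal {n. even n}))"
      then obtain A where "\<And>n. n \<ge> A \<Longrightarrow> even n \<Longrightarrow> P n"
        by (auto simp: eventually_inf_principal eventually_sequentially)
      then show "eventually P (filtermap (\<lambda>m. 2 * m) sequentially)"
        by (auto simp: eventually_filtermap eventually_sequentially intro!: exI[of _ A])
    next
      assume "eventually P (filtermap (\<lambda>m. 2 * m) sequentially)"
      then obtain A where "\<And>m. m \<ge> A \<Longrightarrow> P (2 * m)"
        by (auto simp: eventually_filtermap eventually_sequentially)
      then show "eventually P (inf sequentially (principal {n. even n}))"
        by (auto simp: eventually_inf_principal eventually_sequentially elim!: evenE intro!: exI[of _ "2 * A"])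
    qed
  qed
  then show ?thesis by (simp add: filterlim_filtermap)
qed

lemma linear_lower_bound_at_top:
  assumes "0 < c" "\<forall>\<^sub>F n in sequentially. c * real n \<le> real (f n)"
  shows "filterlim f at_top sequentially"
proof -
  have "filterlim (\<lambda>n. c * real n) at_top sequentially"
    using assms(1) by (intro filterlim_tendsto_pos_mult_at_top[OF tendsto_const _ filterlim_real_sequentially])
  then have "filterlim (\<lambda>n. real (f n)) at_top sequentially"
    using assms(2) by (rule filterlim_at_top_mono)
  then show ?thesis by (simp add: filterlim_sequentially_iff_filterlim_real)
qed

lemma powr_neg_tendsto_0: "0 < s \<Longrightarrow> (\<lambda>n. B * real n powr (- s)) \<longlonglongrightarrow> 0"
  using tendsto_mult[OF tendsto_const tendsto_neg_powr[OF _ filterlim_real_sequentially], of "- s" B] by simp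

text \<open>For \<open>z \<le> 2\<close> the powers of 4 cancel. Both parts have size at least
  \<open>c * m\<close>, so the two numerator factors give order m^(-2s) against m^(-s) in the
  denominator.\<close>

lemma D_ratio_tendsto:
  assumes "0 < z" "0 < c"
    and p: "\<forall>\<^sub>F m in sequentially. c * real m \<le> real (p m)"
    and r: "\<forall>\<^sub>F m in sequentially. c * real m \<le> real (m - p m)"
  shows "(\<lambda>m. D (2 * p m) z * D (2 * (m - p m)) z / D (2 * m) z)
    \<longlonglongrightarrow> (if z \<le> 2 then 0 else (z - 2) / (z - 1))"
proof (cases "z \<le> 2")
  case False
  then have z: "2 < z" by simp
  have "(\<lambda>m. D (2 * p m) z * D (2 * (m - p m)) z / D (2 * m) z) \<longlonglongrightarrow> (z - 2) / (z - 1)"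
    using z growth_rate_gt_4[OF z refl]
    by (intro split_ratio_tendsto[OF D_asymp_gt_2[OF z refl] D_asymp_gt_2[OF z refl]]
        linear_lower_bound_at_top[OF assms(2)] p r) auto
  then show ?thesis using z by simp
next
  case True
  from growth_le_two[OF assms(1) True] obtain s A B C where
    "0 < s" "0 < A" "0 < B"
    and lower: "\<And>m. 1 \<le> m \<Longrightarrow> A * (4 ^ m / real m powr s) \<le> D (2 * m) z"
    and upper: "\<And>m. 1 \<le> m \<Longrightarrow> D (2 * m) z \<le> B * (4 ^ m / real m powr s)"
    by metis
  define E where "E = B * B / A / (c powr s * c powr s)"
  have bound: "\<forall>\<^sub>F m in sequentially. D (2 * p m) z * D (2 * (m - p m)) z / D (2 * m) z \<le> E * real m powr (- s)"
    using p r eventually_ge_at_top[of 1]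
  proof eventually_elim
    case (elim m)
    have pos: "0 < c * real m" using elim assms by simp
    then have p1: "1 \<le> p m" and r1: "1 \<le> m - p m" using elim by linarith+
    have U: "D (2 * k) z \<le> B * (4 ^ k / (c * real m) powr s)" if "1 \<le> k" "c * real m \<le> real k" for k
    proof -
      have "B * (4 ^ k / real k powr s) \<le> B * (4 ^ k / (c * real m) powr s)"
        using that pos elim(3) \<open>0 < s\<close> \<open>0 < B\<close>
        by (intro mult_left_mono divide_left_mono powr_mono2 mult_pos_pos) auto
      with upper[OF that(1)] show ?thesis by linarith
    qed
    have "D (2 * p m) z * D (2 * (m - p m)) z / D (2 * m) z
        \<le> (B * (4 ^ p m / (c * real m) powr s)) * (B * (4 ^ (m - p m) / (c * real m) powr s))
          / (A * (4 ^ m / real m powr s))"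
      using U[OF p1] U[OF r1] lower[of m] elim pos \<open>0 < A\<close> \<open>0 < B\<close> assms(1)
      by (intro frac_le mult_mono) (auto simp: D_nonneg)
    also have "\<dots> = E * real m powr (- s)"
    proof -
      have "4 ^ p m * 4 ^ (m - p m) = (4::real) ^ m" using r1 by (simp flip: power_add)
      then have "(4::real) ^ m = 4 ^ p m * 4 ^ (m - p m)" ..
      moreover have "(c * real m) powr s = c powr s * real m powr s"
        using assms(2) by (simp add: powr_mult)
      ultimately show ?thesis
        using \<open>0 < A\<close> assms(2) elim by (simp add: E_def powr_minus field_simps)
    qed
    finally show ?case .
  qed
  have "(\<lambda>m. D (2 * p m) z * D (2 * (m - p m)) z / D (2 * m) z) \<longlonglongrightarrow> 0"
    by (rule tendsto_sandwich[OF _ bound tendsto_const powr_neg_tendsto_0[OF \<open>0 < s\<close>]])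
       (use assms in \<open>auto simp: D_nonneg\<close>)
  then show ?thesis using True by simp
qed

text \<open>For \<open>z \<le> 2\<close> the crude bound \<open>2 ^ (n - 2 * p n)\<close> on the
  second factor suffices: \<open>D\<close> contributes n^(-s) and 1/T at most n^(s - 1/2), leaving
  n^(-1/2). For \<open>z > 2\<close> the two parities of \<open>n\<close> are treated
  separately.\<close>

lemma T_ratio_tendsto:
  assumes "0 < z" "0 < c"
    and p: "\<forall>\<^sub>F n in sequentially. c * real n \<le> real (p n)"
    and r: "\<forall>\<^sub>F n in sequentially. c * real n \<le> real (n - 2 * p n)"
  shows "(\<lambda>n. D (2 * p n) z * T (n - 2 * p n) z / T n z)
    \<longlonglongrightarrow> (if z \<le> 2 then 0 else (z - 2) / (z - 1))"
proof (cases "z \<le> 2")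
  case False
  then have z: "2 < z" by simp
  have sub: "filterlim (\<lambda>m. 2 * m) at_top sequentially" "filterlim (\<lambda>m. Suc (2 * m)) at_top sequentially"
    by (auto intro!: filterlim_subseq strict_monoI)
  have even: "(\<lambda>m. D (2 * p (2 * m)) z * T (2 * (m - p (2 * m))) z / T (2 * m) z) \<longlonglongrightarrow> (z - 2) / (z - 1)"
  proof (rule split_ratio_tendsto[OF D_asymp_gt_2[OF z refl] T_even_asymp_gt_2[OF z refl]])
    show "filterlim (\<lambda>m. p (2 * m)) at_top sequentially"
      by (rule filterlim_compose[OF linear_lower_bound_at_top[OF assms(2) p] sub(1)])
    show "filterlim (\<lambda>m. m - p (2 * m)) at_top sequentially"
      using eventually_compose_filterlim[OF r sub(1)]
      by (intro linear_lower_bound_at_top[OF assms(2)]) (auto elim!: eventually_mono)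
  qed (use growth_rate_gt_4[OF z refl] in auto)
  have odd: "(\<lambda>m. D (2 * p (Suc (2 * m))) z * T (Suc (2 * (m - p (Suc (2 * m))))) z / T (Suc (2 * m)) z)
      \<longlonglongrightarrow> (z - 2) / (z - 1)"
  proof (rule split_ratio_tendsto[OF D_asymp_gt_2[OF z refl] T_odd_asymp_gt_2[OF z refl]])
    show "filterlim (\<lambda>m. p (Suc (2 * m))) at_top sequentially"
      by (rule filterlim_compose[OF linear_lower_bound_at_top[OF assms(2) p] sub(2)])
    \<comment> \<open>Halving an odd length loses a 1, which \<open>c * m\<close> absorbs once m
      \<ge> 1/c; hence the constant \<open>c / 2\<close>.\<close>
    have "\<forall>\<^sub>F m in sequentially. c / 2 * real m \<le> real (m - p (Suc (2 * m)))"
      using eventually_compose_filterlim[OF r sub(2)]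
        filterlim_at_top[THEN iffD1, OF filterlim_real_sequentially, rule_format, of "1 / c"]
    proof eventually_elim
      case (elim m)
      have "1 \<le> c * real m" using elim(2) assms(2) by (simp add: field_simps)
      moreover have "2 * (c * real m) + c \<le> real (Suc (2 * m) - 2 * p (Suc (2 * m)))"
        using elim(1) by (simp add: algebra_simps)
      moreover have "real (Suc (2 * m) - 2 * p (Suc (2 * m))) \<le> 2 * real (m - p (Suc (2 * m))) + 1"
        by linarith
      ultimately have "c * real m \<le> 2 * real (m - p (Suc (2 * m)))" using assms(2) by linarith
      then show ?case by simp
    qed
    then show "filterlim (\<lambda>m. m - p (Suc (2 * m))) at_top sequentially"
      using assms(2) by (intro linear_lower_bound_at_top[of "c / 2"]) auto
  qed (use growth_rate_gt_4[OF z refl] z in auto)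
  have "(\<lambda>n. D (2 * p n) z * T (n - 2 * p n) z / T n z) \<longlonglongrightarrow> (z - 2) / (z - 1)"
  proof (rule tendsto_even_odd)
    show "(\<lambda>m. D (2 * p (2 * m)) z * T (2 * m - 2 * p (2 * m)) z / T (2 * m) z) \<longlonglongrightarrow> (z - 2) / (z - 1)"
      using even by (simp add: diff_mult_distrib2)
    show "(\<lambda>m. D (2 * p (Suc (2 * m))) z * T (Suc (2 * m) - 2 * p (Suc (2 * m))) z / T (Suc (2 * m)) z)
        \<longlonglongrightarrow> (z - 2) / (z - 1)"
    proof (rule Lim_transform_eventually[OF odd])
      show "\<forall>\<^sub>F m in sequentially.
          D (2 * p (Suc (2 * m))) z * T (Suc (2 * (m - p (Suc (2 * m))))) z / T (Suc (2 * m)) z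
          = D (2 * p (Suc (2 * m))) z * T (Suc (2 * m) - 2 * p (Suc (2 * m))) z / T (Suc (2 * m)) z"
        using eventually_compose_filterlim[OF r sub(2)]
      proof eventually_elim
        case (elim m)
        \<comment> \<open>A positive truncated difference forces
          \<open>p (Suc (2 * m)) \<le> m\<close>, so \<open>Suc\<close> can be moved outside the
          subtraction.\<close>
        have "0 < c * real (Suc (2 * m))" using assms(2) by simp
        then have "0 < Suc (2 * m) - 2 * p (Suc (2 * m))" using elim by linarith
        then have "Suc (2 * (m - p (Suc (2 * m)))) = Suc (2 * m) - 2 * p (Suc (2 * m))" by linarith
        then show ?case by simp
      qed
    qed
  qed
  then show ?thesis using z by simp
next
  case True
  from growth_le_two[OF assms(1) True] obtain s A B C where
    "0 < s" "0 < B" "0 < C"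
    and upper: "\<And>m. 1 \<le> m \<Longrightarrow> D (2 * m) z \<le> B * (4 ^ m / real m powr s)"
    and lower: "\<And>n. 1 \<le> n \<Longrightarrow> C * (2 ^ n / real n powr (s - 1 / 2)) \<le> T n z"
    by metis
  define E where "E = B / C / c powr s"
  have bound: "\<forall>\<^sub>F n in sequentially. D (2 * p n) z * T (n - 2 * p n) z / T n z \<le> E * real n powr (- (1 / 2))"
    using p r eventually_ge_at_top[of 1]
  proof eventually_elim
    case (elim n)
    have pos: "0 < c * real n" using elim assms by simp
    then have p1: "1 \<le> p n" and r1: "1 \<le> n - 2 * p n" using elim by linarith+
    have "B * (4 ^ p n / real (p n) powr s) \<le> B * (4 ^ p n / (c * real n) powr s)"
      using elim pos \<open>0 < s\<close> \<open>0 < B\<close> p1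
      by (intro mult_left_mono divide_left_mono powr_mono2 mult_pos_pos) auto
    with upper[OF p1] have U: "D (2 * p n) z \<le> B * (4 ^ p n / (c * real n) powr s)" by linarith
    have "D (2 * p n) z * T (n - 2 * p n) z / T n z
        \<le> (B * (4 ^ p n / (c * real n) powr s)) * 2 ^ (n - 2 * p n)
          / (C * (2 ^ n / real n powr (s - 1 / 2)))"
      using U lower[of n] T_le_power[of z "n - 2 * p n"] elim pos \<open>0 < B\<close> \<open>0 < C\<close> assms(1) True
        T_pos[of z "n - 2 * p n"]
      by (intro frac_le mult_mono) (auto simp: D_nonneg less_imp_le)
    also have "\<dots> = E * real n powr (- (1 / 2))"
    proof -
      have "4 ^ p n * 2 ^ (n - 2 * p n) = (2::real) ^ (2 * p n + (n - 2 * p n))"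
        by (simp add: power_add power_mult)
      then have "(2::real) ^ n = 4 ^ p n * 2 ^ (n - 2 * p n)" using r1 by simp
      moreover have "(c * real n) powr s = c powr s * real n powr s"
        using assms(2) by (simp add: powr_mult)
      moreover have "real n powr (- (1 / 2)) = real n powr (s - 1 / 2) / real n powr s"
        by (simp flip: powr_diff)
      ultimately show ?thesis
        using \<open>0 < C\<close> assms(2) elim by (simp add: E_def field_simps)
    qed
    finally show ?case .
  qed
  have "(\<lambda>n. D (2 * p n) z * T (n - 2 * p n) z / T n z) \<longlonglongrightarrow> 0"
    by (rule tendsto_sandwich[OF _ bound tendsto_const powr_neg_tendsto_0[OF half_gt_zero[OF zero_less_one]]])
       (use assms T_pos in \<open>auto simp: D_nonneg less_imp_le\<close>)
  then show ?thesis using True by simp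
qed

section \<open>From ratios to pressures\<close>

lemma ln_diff_tendsto:
  fixes f g :: "nat \<Rightarrow> real"
  assumes "\<And>n. 0 < g n" "R \<longlonglongrightarrow> L" "L < 1" "\<forall>\<^sub>F n in sequentially. f n = g n - R n * g n"
  shows "(\<lambda>n. ln (f n) - ln (g n)) \<longlonglongrightarrow> ln (1 - L)"
proof (rule Lim_transform_eventually)
  show "(\<lambda>n. ln (1 - R n)) \<longlonglongrightarrow> ln (1 - L)"
    using assms(2,3) by (intro tendsto_ln tendsto_diff tendsto_const) auto
  show "\<forall>\<^sub>F n in sequentially. ln (1 - R n) = ln (f n) - ln (g n)"
    using assms(4) order_tendstoD(2)[OF assms(2,3)]
  proof eventually_elim
    case (elim n)
    \<comment> \<open>Since \<open>L < 1\<close>, eventually \<open>R n < 1\<close>; both factors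
      are then positive and the logarithm splits without default values.\<close>
    have "f n = (1 - R n) * g n" using elim by (simp add: algebra_simps)
    then show ?case using elim assms(1)[of n] by (simp add: ln_mult)
  qed
qed

lemma eventually_floor_ge:
  assumes "0 < b"
  shows "\<forall>\<^sub>F n in sequentially. b / 2 * real n \<le> real (nat \<lfloor>b * real n\<rfloor>)"
proof -
  have "\<forall>\<^sub>F n in sequentially. 2 / b \<le> real n"
    using filterlim_real_sequentially by (auto simp: filterlim_at_top)
  then show ?thesis
  proof eventually_elim
    \<comment> \<open>Taking the floor loses less than 1, at most half of \<open>b * n\<close> once
      \<open>b * n\<close> is at least 2.\<close>
    case (elim n)
    then have "2 \<le> b * real n" using assms by (simp add: field_simps)
    then show ?case by linarith
  qed
qed

theorem mainTheorem1:
  fixes a z :: real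
  assumes "0 < a" and "a < 1" and "0 < z"
  shows "((\<lambda>n. pressure_T n z (2 * \<lfloor>a * real n / 2\<rfloor>))
            \<longlongrightarrow> (if z \<le> 2 then 0 else - ln (z - 1))) sequentially
       \<and> ((\<lambda>n. pressure_D n z (2 * \<lfloor>a * real n / 2\<rfloor>))
            \<longlongrightarrow> (if z \<le> 2 then 0 else - ln (z - 1))) (inf sequentially (principal {n. even n}))"
proof
  define L where "L = (if z \<le> 2 then 0 else (z - 2) / (z - 1))"
  have L: "L < 1" by (simp add: L_def)
  have "1 - L = 1 / (z - 1)" if "2 < z" using that by (simp add: L_def field_simps)
  then have ln_L: "ln (1 - L) = (if z \<le> 2 then 0 else - ln (z - 1))"
    by (auto simp: L_def ln_div)
  show "((\<lambda>n. pressure_T n z (2 * \<lfloor>a * real n / 2\<rfloor>))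
            \<longlongrightarrow> (if z \<le> 2 then 0 else - ln (z - 1))) sequentially"
  proof -
    define p where "p n = nat \<lfloor>a / 2 * real n\<rfloor>" for n
    have p_int: "2 * \<lfloor>a * real n / 2\<rfloor> = int (2 * p n)" for n
      using assms by (simp add: p_def)
    have p_le: "2 * real (p n) \<le> a * real n" for n
      using assms by (simp add: p_def) linarith
    \<comment> \<open>\<open>a / 4\<close> is half the slope of \<open>p\<close>, to allow for the
      floor; \<open>1 - a\<close> comes from \<open>2 * p n \<le> a * n\<close>.\<close>
    define c where "c = min (a / 4) (1 - a)"
    have c_le: "c \<le> a / 4" "c \<le> 1 - a"
      by (simp_all only: c_def min.cobounded1 min.cobounded2)
    have c: "0 < c" using assms by (simp add: c_def)
    have cn: "c * real n \<le> a / 4 * real n" "c * real n \<le> (1 - a) * real n" for n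
      by (intro mult_right_mono c_le of_nat_0_le_iff)+
    have p: "\<forall>\<^sub>F n in sequentially. c * real n \<le> real (p n)"
      using eventually_floor_ge[OF half_gt_zero[OF assms(1)]]
    proof eventually_elim
      case (elim n)
      then show ?case using cn(1)[of n] unfolding p_def by linarith
    qed
    have r: "c * real n \<le> real (n - 2 * p n)" for n
    proof -
      have "a * real n \<le> real n" using assms by (simp add: mult_left_le_one_le)
      then have "real (n - 2 * p n) = real n - 2 * real (p n)" using p_le[of n] by linarith
      then show ?thesis using p_le[of n] cn(2)[of n] by (simp add: algebra_simps)
    qed
    have "(\<lambda>n. D (2 * p n) z * T (n - 2 * p n) z / T n z) \<longlonglongrightarrow> L"
      unfolding L_def using p r c assms by (intro T_ratio_tendsto[of z c]) auto
    moreover have "\<forall>\<^sub>F n in sequentially. T_avoiding n z (int (2 * p n))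
        = T n z - D (2 * p n) z * T (n - 2 * p n) z / T n z * T n z"
      using p eventually_ge_at_top[of 1]
    proof eventually_elim
      case (elim n)
      \<comment> \<open>The linear bounds place \<open>q = 2 * p n\<close> strictly between 0 and
        \<open>n\<close>, as the decomposition and the meaning of the pressure demand.\<close>
      then have "0 < c * real n" using c by simp
      then have "0 < real (p n)" "0 < real (n - 2 * p n)" using elim r[of n] by linarith+
      then show ?case using T_avoiding_decomp[of "2 * p n" n z] T_pos[OF assms(3), of n] by simp
    qed
    ultimately have "(\<lambda>n. ln (T_avoiding n z (int (2 * p n))) - ln (T n z)) \<longlonglongrightarrow> ln (1 - L)"
      using T_pos[OF assms(3)] L by (intro ln_diff_tendsto)
    then show ?thesis unfolding pressure_T_def p_int ln_L .
  qed
  show "((\<lambda>n. pressure_D n z (2 * \<lfloor>a * real n / 2\<rfloor>))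
            \<longlongrightarrow> (if z \<le> 2 then 0 else - ln (z - 1))) (inf sequentially (principal {n. even n}))"
  proof -
    \<comment> \<open>With \<open>n = 2 * m\<close> the floor becomes that of \<open>a * m\<close>,
      so the slope is \<open>a\<close> and the constant below starts from
      \<open>a / 2\<close>.\<close>
    define p where "p m = nat \<lfloor>a * real m\<rfloor>" for m
    have p_int: "2 * \<lfloor>a * real (2 * m) / 2\<rfloor> = int (2 * p m)" for m
      using assms by (simp add: p_def)
    have p_le: "real (p m) \<le> a * real m" for m
      using assms by (simp add: p_def)
    define c where "c = min (a / 2) (1 - a)"
    have c_le: "c \<le> a / 2" "c \<le> 1 - a"
      by (simp_all only: c_def min.cobounded1 min.cobounded2)
    have c: "0 < c" using assms by (simp add: c_def)
    have cm: "c * real m \<le> a / 2 * real m" "c * real m \<le> (1 - a) * real m" for m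
      by (intro mult_right_mono c_le of_nat_0_le_iff)+
    have p: "\<forall>\<^sub>F m in sequentially. c * real m \<le> real (p m)"
      using eventually_floor_ge[OF assms(1)]
    proof eventually_elim
      case (elim n)
      then show ?case using cm(1)[of n] unfolding p_def by linarith
    qed
    have r: "c * real m \<le> real (m - p m)" for m
    proof -
      have "a * real m \<le> real m" using assms by (simp add: mult_left_le_one_le)
      then have "real (m - p m) = real m - real (p m)" using p_le[of m] by linarith
      then show ?thesis using p_le[of m] cm(2)[of m] by (simp add: algebra_simps)
    qed
    have "(\<lambda>m. D (2 * p m) z * D (2 * (m - p m)) z / D (2 * m) z) \<longlonglongrightarrow> L"
      unfolding L_def using p r c assms by (intro D_ratio_tendsto[of z c]) auto
    moreover have "\<forall>\<^sub>F m in sequentially. D_avoiding (2 * m) z (int (2 * p m))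
        = D (2 * m) z - D (2 * p m) z * D (2 * (m - p m)) z / D (2 * m) z * D (2 * m) z"
      using p eventually_ge_at_top[of 1]
    proof eventually_elim
      case (elim m)
      then have "0 < c * real m" using c by simp
      then have "0 < real (p m)" "0 < real (m - p m)" using elim r[of m] by linarith+
      then show ?case
        using D_avoiding_decomp[of "2 * p m" "2 * m" z] D_pos[OF assms(3), of m]
        by (simp add: diff_mult_distrib2)
    qed
    ultimately have "(\<lambda>m. ln (D_avoiding (2 * m) z (int (2 * p m))) - ln (D (2 * m) z)) \<longlonglongrightarrow> ln (1 - L)"
      using D_pos[OF assms(3)] L by (intro ln_diff_tendsto)
    then show ?thesis unfolding tendsto_even_filter_iff pressure_D_def p_int ln_L .
  qed
qed

end
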